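(* Let $\mathbf{X}\neq 0$. Suppose that steepest descent in the norm $\|\cdot\|$ is applied to the logistic loss $L_n(\cdot)$, initialized at $\beta^0:=0$, with the step-size rule $$\alpha_k := \frac{4n\|\nabla L_n(\beta^k)\|_*}{\|\mathbf{X}\|_{\cdot,2}^2}\quad\text{for all } k\ge 0.$$ When the data is non-separable, for all $k\ge 0$ it holds that: (i) (training error) $$L_n(\beta^k)-L_n^* \ \le\ \frac{1}{\dfrac{1}{\ln(2)-L_n^*}+\dfrac{k\cdot n\cdot(\mathrm{DegNSEP}^* )^2}{2\|\mathbf{X}\|_{\cdot,2}^2(\ln(2))^2}}\ <\ \frac{2\|\mathbf{X}\|_{\cdot,2}^2(\ln(2))^2}{k\cdot n\cdot(\mathrm{DegNSEP}^* )^2};$$ (ii) (shrinkage) $$\|\beta^k\| \le \sqrt{k}\Big(\frac{1}{\|\mathbf{X}\|_{\cdot,2}}\Big)\sqrt{8n(\ln(2)-L_n^* )} \le \sqrt{k}\Big(\frac{1}{\|\mathbf{X}\|_{\cdot,2}}\Big)\sqrt{8n\ln(2)};$$ (iii) (gradient bound) $$\|\nabla L_n(\beta^k)\|_* \le \|\mathbf{X}\|_{\cdot,2}\sqrt{\frac{L_n(\beta^k)-L_n^*}{2n}} \le \frac{\|\mathbf{X}\|_{\cdot,2}^2\ln(2)}{\sqrt{k}\cdot n\cdot \mathrm{DegNSEP}^*}.$$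
   Context: Data: $\mathbf{x}_i\in\mathbb{R}^p$, $y_i\in\{-1,1\}$, $i=1,\ldots,n$; $\mathbf{X}\in\mathbb{R}^{n\times p}$ is the matrix whose $i$-th row is $\mathbf{x}_i$. The data is separable if there is $\beta$ with $y_i\beta^T\mathbf{x}_i>0$ for all $i$, and non-separable otherwise. $\|\cdot\|$ is a given (arbitrary) norm on $\mathbb{R}^p$ with dual norm $\|s\|_* := \max_{\|x\|\le1}s^Tx$, and $\|\mathbf{X}\|_{\cdot,2}:=\max_{\|\beta\|\le 1}\|\mathbf{X}\beta\|_2$. The logistic loss is $L_n(\beta):=\frac1n\sum_{i=1}^n\ln(1+\exp(-y_i\beta^T\mathbf{x}_i))$ and $L_n^*:=\inf_\beta L_n(\beta)$. With $[t]^-:=\max\{-t,0\}$, $$\mathrm{DegNSEP}^* := \min_{\|\beta\|=1}\frac1n\sum_{i=1}^n[y_i\beta^T\mathbf{x}_i]^-.$$ Steepest descent in the norm $\|\cdot\|$ for a differentiable function $f$: given $x^0$, at each iteration $k\ge0$ choose $d^k\in\arg\max_d\{\nabla f(x^k)^Td:\|d\|\le1\}$ (any maximizer), and set $x^{k+1}:=x^k-\alpha_kd^k$ with $\alpha_k\ge0$. Here $f=L_n$ and the iterates are denoted $\beta^k$. Conventions: $c/0=+\infty$ for $c>0$ and $1/(+\infty)=0$. *)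

theory Defs
  imports "HOL-Analysis.Analysis"
begin

definition is_norm :: "('a::real_vector \<Rightarrow> real) \<Rightarrow> bool" where
  "is_norm N \<longleftrightarrow>
     (\<forall>x. 0 \<le> N x) \<and> (\<forall>x. N x = 0 \<longleftrightarrow> x = 0) \<and>
     (\<forall>c x. N (c *\<^sub>R x) = \<bar>c\<bar> * N x) \<and> (\<forall>x y. N (x + y) \<le> N x + N y)"

(* In dual_norm, op_norm_2 and DegNSEP below, the maxima and minima are of continuous functions
   over nonempty compact sets (whenever N is a norm), so they are attained and coincide with
   the suprema and infima used here. *)

definition dual_norm :: "(real^'p \<Rightarrow> real) \<Rightarrow> real^'p \<Rightarrow> real" where
  "dual_norm N s = (SUP x\<in>{x. N x \<le> 1}. s \<bullet> x)"

definition op_norm_2 :: "(real^'p \<Rightarrow> real) \<Rightarrow> real^'p^'n \<Rightarrow> real" where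
  "op_norm_2 N X = (SUP \<beta>\<in>{\<beta>. N \<beta> \<le> 1}. norm (X *v \<beta>))"

definition separable :: "real^'p^'n \<Rightarrow> real^'n \<Rightarrow> bool" where
  "separable X y \<longleftrightarrow> (\<exists>\<beta>. \<forall>i. y $ i * (\<beta> \<bullet> row i X) > 0)"

definition logistic_loss :: "real^'p^'n \<Rightarrow> real^'n \<Rightarrow> real^'p \<Rightarrow> real" where
  "logistic_loss X y \<beta> =
     1 / real CARD('n) * (\<Sum>i\<in>UNIV. ln (1 + exp (- (y $ i * (\<beta> \<bullet> row i X)))))"

definition logistic_loss_inf :: "real^'p^'n \<Rightarrow> real^'n \<Rightarrow> real" where
  "logistic_loss_inf X y = (INF \<beta>. logistic_loss X y \<beta>)"

definition neg_part :: "real \<Rightarrow> real" where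
  "neg_part t = max (- t) 0"

definition DegNSEP :: "(real^'p \<Rightarrow> real) \<Rightarrow> real^'p^'n \<Rightarrow> real^'n \<Rightarrow> real" where
  "DegNSEP N X y =
     (INF \<beta>\<in>{\<beta>. N \<beta> = 1}. 1 / real CARD('n) * (\<Sum>i\<in>UNIV. neg_part (y $ i * (\<beta> \<bullet> row i X))))"

definition gradient :: "('a::real_inner \<Rightarrow> real) \<Rightarrow> 'a \<Rightarrow> 'a" where
  "gradient f x = (THE g. GDERIV f x :> g)"

(* The direction at each step is an arbitrary maximizer, not a fixed selection. *)
definition steepest_descent ::
  "(real^'p \<Rightarrow> real) \<Rightarrow> (real^'p \<Rightarrow> real) \<Rightarrow> (nat \<Rightarrow> real) \<Rightarrow> real^'p \<Rightarrow> (nat \<Rightarrow> real^'p) \<Rightarrow> bool" where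
  "steepest_descent N f \<alpha> x0 x \<longleftrightarrow>
     x 0 = x0 \<and>
     (\<forall>k. 0 \<le> \<alpha> k \<and>
        (\<exists>d. is_arg_max (\<lambda>d. gradient f (x k) \<bullet> d) (\<lambda>d. N d \<le> 1) d \<and>
             x (Suc k) = x k - \<alpha> k *\<^sub>R d))"

end

theory Submission
  imports Defs
begin

text \<open>
  The loss is \<open>(\<parallel>X\<parallel>\<^sup>2 / 4n)\<close>-smooth with respect to the norm, because the second derivative of
  \<open>t \<mapsto> ln (1 + exp (- t))\<close> lies in \<open>[0, 1/4]\<close>. The prescribed step minimizes the resulting quadratic
  upper bound and decreases the loss by at least \<open>2n G\<^sup>2 / \<parallel>X\<parallel>\<^sup>2\<close>, where \<open>G\<close> is the dual norm of the
  gradient. Summing these decreases and applying Cauchy-Schwarz bounds the length of the path.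
  Since \<open>ln (1 + exp (- t)) \<ge> [t]\<^sup>-\<close>, the loss at \<open>\<beta>\<close> is at least \<open>DegNSEP \<cdot> \<parallel>\<beta>\<parallel>\<close>, so the sublevel set
  of \<open>0\<close> has radius at most \<open>ln 2 / DegNSEP\<close>; with convexity, the optimality gap \<open>e\<close> satisfies
  \<open>e \<le> G \<cdot> 2 ln 2 / DegNSEP\<close>. Hence \<open>e\<^sub>k\<^sub>+\<^sub>1 \<le> e\<^sub>k - c e\<^sub>k\<^sup>2\<close>, which gives the rate \<open>1/k\<close>.
\<close>

section \<open>Norms on Euclidean space and duality\<close>

lemma is_normD:
  assumes "is_norm N"
  shows "0 \<le> N x" "N x = 0 \<longleftrightarrow> x = 0" "N (c *\<^sub>R x) = \<bar>c\<bar> * N x" "N (x + y) \<le> N x + N y"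
  using assms by (auto simp: is_norm_def)

lemma is_norm_diff_le:
  assumes "is_norm N"
  shows "N (x - y) \<le> N x + N y"
  using is_normD(4)[OF assms, of x "- y"] is_normD(3)[OF assms, of "-1" y] by simp

text \<open>The triangle inequality and homogeneity make \<open>N\<close> convex, and a finite
  convex function on a finite-dimensional space is continuous.\<close>

lemma continuous_on_is_norm:
  fixes N :: "'a::euclidean_space \<Rightarrow> real"
  assumes "is_norm N"
  shows "continuous_on UNIV N"
proof (rule convex_on_continuous)
  show "convex_on UNIV N"
    using is_normD(4)[OF assms] by (intro convex_onI) (metis is_normD(3)[OF assms] abs_of_nonneg
        diff_ge_0_iff_ge less_imp_le, simp)
qed simp

text \<open>By compactness \<open>N\<close> attains a positive minimum on the Euclidean unit sphere;
  homogeneity turns its reciprocal into the constant \<open>C\<close>. This bounds the set whose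
  supremum is \<open>op_norm_2\<close>.\<close>

lemma is_norm_dominates_norm:
  fixes N :: "'a::euclidean_space \<Rightarrow> real"
  assumes N: "is_norm N"
  obtains C where "0 < C" "\<And>x. norm x \<le> C * N x"
proof -
  have "continuous_on (sphere 0 1) N"
    using continuous_on_is_norm[OF N] continuous_on_subset by blast
  moreover have "sphere (0::'a) 1 \<noteq> {}"
    by simp
  ultimately obtain u where u: "u \<in> sphere 0 1" "\<And>x. x \<in> sphere 0 1 \<Longrightarrow> N u \<le> N x"
    using continuous_attains_inf[of "sphere (0::'a) 1" N] by auto
  have pos: "0 < N u"
    using u(1) is_normD(1,2)[OF N, of u] by (cases "u = 0") auto
  have "norm x \<le> 1 / N u * N x" for x
  proof (cases "x = 0")
    case False
    then have "N u \<le> N ((1 / norm x) *\<^sub>R x)"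
      by (intro u(2)) simp
    then show ?thesis
      using False pos by (simp add: is_normD(3)[OF N] field_simps)
  qed (use pos is_normD(1)[OF N] in simp)
  then show thesis
    using pos that[of "1 / N u"] by simp
qed

text \<open>Rescaling \<open>v\<close> to the unit sphere gives the generalized Hoelder inequality,
  with the maximal value \<open>g \<bullet> d\<close> as the dual norm of \<open>g\<close>.\<close>

lemma is_arg_max_inner_le:
  assumes N: "is_norm N" and d: "is_arg_max (\<lambda>d. g \<bullet> d) (\<lambda>d. N d \<le> 1) d"
  shows "g \<bullet> v \<le> (g \<bullet> d) * N v"
proof (cases "v = 0")
  case False
  then have pos: "0 < N v"
    using is_normD(1,2)[OF N, of v] by linarith
  then have "N ((1 / N v) *\<^sub>R v) \<le> 1"
    by (simp add: is_normD(3)[OF N])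
  then have "g \<bullet> ((1 / N v) *\<^sub>R v) \<le> g \<bullet> d"
    using d unfolding is_arg_max_linorder by blast
  then show ?thesis
    using pos by (simp add: field_simps)
qed (use is_normD(2)[OF N, of 0] in simp)

lemma dual_norm_arg_max:
  assumes "is_arg_max (\<lambda>d. g \<bullet> d) (\<lambda>d. N d \<le> 1) d"
  shows "dual_norm N g = g \<bullet> d"
  unfolding dual_norm_def
  by (rule cSup_eq_maximum) (use assms in \<open>auto simp: is_arg_max_linorder\<close>)

section \<open>The operator norm of the data matrix\<close>

lemma bdd_above_op_norm_2:
  fixes X :: "real^'p^'n"
  assumes "is_norm N"
  shows "bdd_above ((\<lambda>\<beta>. norm (X *v \<beta>)) ` {\<beta>. N \<beta> \<le> 1})"
proof -
  obtain C where C: "0 < C" "\<And>x. norm x \<le> C * N x"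
    using is_norm_dominates_norm[OF assms] by blast
  have "norm (X *v \<beta>) \<le> onorm ((*v) X) * C" if "N \<beta> \<le> 1" for \<beta>
  proof -
    have "norm (X *v \<beta>) \<le> onorm ((*v) X) * norm \<beta>"
      by (simp add: matrix_vector_mul_bounded_linear onorm)
    also have "norm \<beta> \<le> C"
      using C(1) C(2)[of \<beta>] mult_left_mono[OF that, of C] by linarith
    finally show ?thesis
      by (simp add: mult_left_mono matrix_vector_mul_bounded_linear onorm_pos_le)
  qed
  then show ?thesis
    by (intro bdd_aboveI2) auto
qed

lemma norm_mult_le_op_norm_2:
  fixes X :: "real^'p^'n"
  assumes "is_norm N" "N d \<le> 1"
  shows "norm (X *v d) \<le> op_norm_2 N X"
  unfolding op_norm_2_def
  using bdd_above_op_norm_2[OF assms(1)] assms(2) by (intro cSUP_upper) auto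

lemma op_norm_2_pos:
  fixes X :: "real^'p^'n"
  assumes N: "is_norm N" and "X \<noteq> 0"
  shows "0 < op_norm_2 N X"
proof -
  obtain v where v: "X *v v \<noteq> 0"
    using \<open>X \<noteq> 0\<close> by (metis matrix_eq matrix_vector_mult_0)
  then have Nv: "0 < N v"
    using is_normD(1,2)[OF N, of v] by (cases "v = 0") auto
  have "0 < norm (X *v ((1 / N v) *\<^sub>R v))"
    using v Nv by (simp add: matrix_vector_mult_scaleR)
  also have "\<dots> \<le> op_norm_2 N X"
    using Nv by (intro norm_mult_le_op_norm_2[OF N]) (simp add: is_normD(3)[OF N])
  finally show ?thesis .
qed

section \<open>The scalar logistic function\<close>

lemma logistic_has_derivative:
  "((\<lambda>t::real. ln (1 + exp (- t))) has_real_derivative - (1 / (1 + exp t))) (at t)"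
proof -
  have "1 + exp (- t) > 0"
    by (simp add: add_pos_pos)
  then show ?thesis
    by (auto intro!: derivative_eq_intros simp: exp_minus field_simps)
qed

lemma logistic_has_second_derivative:
  "((\<lambda>t::real. - (1 / (1 + exp t))) has_real_derivative exp t / (1 + exp t)\<^sup>2) (at t)"
proof -
  have "1 + exp t \<noteq> 0"
    using exp_gt_zero[of t] by linarith
  then show ?thesis
    by (auto intro!: derivative_eq_intros simp: power2_eq_square)
qed

lemma logistic_above_tangent:
  fixes s t :: real
  shows "ln (1 + exp (- t)) - 1 / (1 + exp t) * (s - t) \<le> ln (1 + exp (- s))"
proof -
  have "convex_on UNIV (\<lambda>t::real. ln (1 + exp (- t)))"
    by (rule f''_ge0_imp_convex[OF _ logistic_has_derivative logistic_has_second_derivative]) auto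
  then have "ln (1 + exp (- s)) - ln (1 + exp (- t)) \<ge> - (1 / (1 + exp t)) * (s - t)"
    by (rule convex_on_imp_above_tangent) (use logistic_has_derivative[of t] in auto)
  then show ?thesis
    by simp
qed

text \<open>The second derivative of the logistic function is at most 1/4, so
  \<open>t\<^sup>2 / 8\<close> minus that function is convex; its tangent inequality rearranges to
  the claim.\<close>

lemma logistic_below_parabola:
  fixes s t :: real
  shows "ln (1 + exp (- s)) \<le> ln (1 + exp (- t)) - 1 / (1 + exp t) * (s - t) + (s - t)\<^sup>2 / 8"
proof -
  define h where "h = (\<lambda>t::real. t\<^sup>2 / 8 - ln (1 + exp (- t)))"
  have h1: "(h has_real_derivative t / 4 - - (1 / (1 + exp t))) (at t)" for t
    unfolding h_def by (rule derivative_eq_intros logistic_has_derivative refl | simp)+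
  have h2: "((\<lambda>t. t / 4 - - (1 / (1 + exp t))) has_real_derivative
      1 / 4 - exp t / (1 + exp t)\<^sup>2) (at t)" for t :: real
    by (intro DERIV_diff logistic_has_second_derivative) (auto intro!: derivative_eq_intros)
  have h3: "1 / 4 - exp t / (1 + exp t)\<^sup>2 \<ge> 0" for t :: real
  proof -
    \<comment> \<open>This is \<open>(1 - exp t)\<^sup>2 \<ge> 0\<close> expanded, and it is where
      the constant 1/4 comes from.\<close>
    have "4 * exp t \<le> (1 + exp t)\<^sup>2"
      using zero_le_power2[of "1 - exp t"] by (simp add: power2_eq_square algebra_simps)
    moreover have "(1 + exp t)\<^sup>2 > 0"
      using exp_gt_zero[of t] by (intro zero_less_power) linarith
    ultimately show ?thesis
      by (simp add: field_simps)
  qed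
  have "convex_on UNIV h"
    by (rule f''_ge0_imp_convex[OF _ h1 h2]) (use h3 in auto)
  then have "h s - h t \<ge> (t / 4 - - (1 / (1 + exp t))) * (s - t)"
    by (rule convex_on_imp_above_tangent) (use h1[of t] in auto)
  moreover have "s\<^sup>2 / 8 - t\<^sup>2 / 8 - t / 4 * (s - t) = (s - t)\<^sup>2 / 8"
    by (simp add: field_simps power2_eq_square)
  ultimately show ?thesis
    by (simp add: h_def left_diff_distrib distrib_right)
qed

text \<open>Both \<open>exp (- t)\<close> and 1 lie below \<open>1 + exp (- t)\<close>; take
  logarithms. This links the loss to \<open>DegNSEP\<close>.\<close>

lemma neg_part_le_logistic: "neg_part t \<le> ln (1 + exp (- t))"
proof -
  have "- t \<le> ln (1 + exp (- t))"
    by (subst ln_ge_iff) (simp_all add: add_pos_pos)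
  moreover have "0 \<le> ln (1 + exp (- t))"
    by (intro ln_ge_zero) simp
  ultimately show ?thesis
    by (simp add: neg_part_def)
qed

section \<open>Gradient, convexity and smoothness of the loss\<close>

definition logistic_gradient :: "real^'p^'n \<Rightarrow> real^'n \<Rightarrow> real^'p \<Rightarrow> real^'p" where
  "logistic_gradient X y \<beta> =
     (1 / real CARD('n)) *\<^sub>R
       (\<Sum>i\<in>UNIV. - (1 / (1 + exp (y $ i * (\<beta> \<bullet> row i X)))) *\<^sub>R (y $ i *\<^sub>R row i X))"

text \<open>The chain rule yields this derivative. Since \<open>gradient\<close> is a definite
  description, uniqueness of the derivative is needed as well.\<close>

lemma gradient_logistic_loss: "gradient (logistic_loss X y) \<beta> = logistic_gradient X y \<beta>"
proof -
  have "((\<lambda>\<beta>. ln (1 + exp (- (y $ i * (\<beta> \<bullet> row i X))))) has_derivative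
      (\<lambda>v. v \<bullet> (- (1 / (1 + exp (y $ i * (\<beta> \<bullet> row i X)))) *\<^sub>R (y $ i *\<^sub>R row i X)))) (at \<beta>)" for i
  proof -
    have "((\<lambda>\<beta>. y $ i * (\<beta> \<bullet> row i X)) has_derivative (\<lambda>v. y $ i * (v \<bullet> row i X))) (at \<beta>)"
      by (auto intro!: derivative_eq_intros)
    from DERIV_compose_FDERIV[OF logistic_has_derivative this]
    show ?thesis
      by (simp add: algebra_simps)
  qed
  then have "((\<lambda>\<beta>. 1 / real CARD('b) * (\<Sum>i\<in>UNIV. ln (1 + exp (- (y $ i * (\<beta> \<bullet> row i X))))))
      has_derivative (\<lambda>v. v \<bullet> logistic_gradient X y \<beta>)) (at \<beta>)"
    unfolding logistic_gradient_def inner_scaleR_right inner_sum_right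
    by (intro has_derivative_mult_right has_derivative_sum) auto
  then have "GDERIV (logistic_loss X y) \<beta> :> logistic_gradient X y \<beta>"
    by (simp add: gderiv_def logistic_loss_def[abs_def])
  then show ?thesis
    unfolding gradient_def
    by (intro the_equality)
       (auto simp: gderiv_def fun_eq_iff vector_eq_ldot dest: has_derivative_unique)
qed

text \<open>Writes the directional derivative as an average over the margins, so that the scalar
  tangent and parabola bounds can be summed term by term.\<close>

lemma inner_logistic_gradient:
  "logistic_gradient X (y :: real^'n) \<beta> \<bullet> (\<gamma> - \<beta>) =
     1 / real CARD('n) * (\<Sum>i\<in>UNIV. - (1 / (1 + exp (y $ i * (\<beta> \<bullet> row i X)))
        * (y $ i * (\<gamma> \<bullet> row i X) - y $ i * (\<beta> \<bullet> row i X))))"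
  unfolding logistic_gradient_def inner_scaleR_left inner_sum_left inner_diff_right
  by (simp add: inner_commute[of "row _ _"] right_diff_distrib sum_subtractf sum_negf
      diff_divide_distrib)

lemma logistic_loss_above_tangent:
  "logistic_loss X y \<beta> + gradient (logistic_loss X y) \<beta> \<bullet> (\<gamma> - \<beta>) \<le> logistic_loss X y \<gamma>"
  unfolding gradient_logistic_loss inner_logistic_gradient logistic_loss_def
    distrib_left[symmetric] sum.distrib[symmetric]
  using logistic_above_tangent by (intro mult_left_mono sum_mono) simp_all

text \<open>As labels square to 1, the squared margin differences are the squared coordinates of
  \<open>X *v (\<gamma> - \<beta>)\<close>; averaging the scalar bounds turns 1/8 into
  1/(8n).\<close>

lemma logistic_loss_below_parabola:
  fixes X :: "real^'p^'n" and y :: "real^'n"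
  assumes "\<forall>i. y $ i \<in> {-1, 1}"
  shows "logistic_loss X y \<gamma> \<le> logistic_loss X y \<beta>
      + gradient (logistic_loss X y) \<beta> \<bullet> (\<gamma> - \<beta>) + (norm (X *v (\<gamma> - \<beta>)))\<^sup>2 / (8 * real CARD('n))"
proof -
  have "(y $ i * (\<gamma> \<bullet> row i X) - y $ i * (\<beta> \<bullet> row i X))\<^sup>2 = ((X *v (\<gamma> - \<beta>)) $ i)\<^sup>2" for i
  proof -
    have "(y $ i)\<^sup>2 = 1"
      using assms by (auto simp: power2_eq_square dest!: spec[of _ i])
    moreover have "y $ i * (\<gamma> \<bullet> row i X) - y $ i * (\<beta> \<bullet> row i X) = y $ i * ((X *v (\<gamma> - \<beta>)) $ i)"
      by (simp add: matrix_vector_mul_component row_def inner_commute inner_diff_right algebra_simps)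
    ultimately show ?thesis
      by (simp add: power_mult_distrib)
  qed
  then have "(norm (X *v (\<gamma> - \<beta>)))\<^sup>2 / (8 * real CARD('n)) = 1 / real CARD('n) *
      (\<Sum>i\<in>UNIV. (y $ i * (\<gamma> \<bullet> row i X) - y $ i * (\<beta> \<bullet> row i X))\<^sup>2 / 8)"
    by (simp add: norm_vec_def L2_set_def sum_nonneg sum_divide_distrib)
  then show ?thesis
    unfolding gradient_logistic_loss inner_logistic_gradient logistic_loss_def
    using logistic_below_parabola
    by (simp only: distrib_left[symmetric] sum.distrib[symmetric])
       (intro mult_left_mono sum_mono; simp)
qed

lemma logistic_loss_nonneg: "0 \<le> logistic_loss X y \<beta>"
  unfolding logistic_loss_def by (intro mult_nonneg_nonneg sum_nonneg ln_ge_zero) auto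

lemma logistic_loss_zero: "logistic_loss X y 0 = ln 2"
  by (simp add: logistic_loss_def)

lemma logistic_loss_inf_le: "logistic_loss_inf X y \<le> logistic_loss X y \<beta>"
  unfolding logistic_loss_inf_def
  by (intro cINF_lower bdd_belowI2[of _ 0]) (auto intro: logistic_loss_nonneg)

lemma logistic_loss_inf_nonneg: "0 \<le> logistic_loss_inf X y"
  unfolding logistic_loss_inf_def by (intro cINF_greatest) (auto intro: logistic_loss_nonneg)

section \<open>The degree of non-separability as a growth rate of the loss\<close>

lemma DegNSEP_le:
  fixes X :: "real^'p^'n"
  assumes "N \<beta> = 1"
  shows "DegNSEP N X y \<le> 1 / real CARD('n) * (\<Sum>i\<in>UNIV. neg_part (y $ i * (\<beta> \<bullet> row i X)))"
  unfolding DegNSEP_def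
proof (rule cINF_lower)
  show "bdd_below ((\<lambda>\<beta>. 1 / real CARD('n) * (\<Sum>i\<in>UNIV. neg_part (y $ i * (\<beta> \<bullet> row i X))))
      ` {\<beta>. N \<beta> = 1})"
    by (rule bdd_belowI2[of _ 0]) (auto intro!: divide_nonneg_nonneg sum_nonneg simp: neg_part_def)
qed (use assms in simp)

lemma DegNSEP_nonneg:
  fixes X :: "real^'p^'n"
  assumes N: "is_norm N"
  shows "0 \<le> DegNSEP N X y"
  unfolding DegNSEP_def
proof (rule cINF_greatest)
  \<comment> \<open>The lower bound on an infimum requires a nonempty set: a coordinate axis
    supplies a nonzero vector to normalize.\<close>
  obtain v :: "real^'p" where "v \<noteq> 0"
    by (metis axis_eq_0_iff one_neq_zero)
  then have "N ((1 / N v) *\<^sub>R v) = 1"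
    using is_normD(1,2)[OF N, of v] by (simp add: is_normD(3)[OF N])
  then show "{\<beta>. N \<beta> = 1} \<noteq> {}"
    by auto
qed (auto intro!: divide_nonneg_nonneg sum_nonneg simp: neg_part_def)

text \<open>The average negative part is positively homogeneous in \<open>\<beta>\<close>, so its
  bound on the unit sphere scales to linear growth, and the loss dominates it. Sublevel sets of the
  loss are thereby bounded when \<open>DegNSEP\<close> is positive.\<close>

lemma DegNSEP_mult_le_logistic_loss:
  fixes X :: "real^'p^'n" and y :: "real^'n"
  assumes N: "is_norm N"
  shows "DegNSEP N X y * N \<beta> \<le> logistic_loss X y \<beta>"
proof (cases "\<beta> = 0")
  case True
  then show ?thesis
    using is_normD(2)[OF N, of 0] logistic_loss_nonneg[of X y 0] by simp
next
  case False
  then have pos: "0 < N \<beta>"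
    using is_normD(1,2)[OF N, of \<beta>] by linarith
  have scale: "neg_part (t / r) * r = neg_part t" if "0 < r" for r t :: real
    using that by (auto simp: neg_part_def max_def field_simps)
  have "DegNSEP N X y * N \<beta> \<le>
      1 / real CARD('n) * (\<Sum>i\<in>UNIV. neg_part (y $ i * (((1 / N \<beta>) *\<^sub>R \<beta>) \<bullet> row i X))) * N \<beta>"
    using pos by (intro mult_right_mono DegNSEP_le) (simp_all add: is_normD(3)[OF N])
  also have "\<dots> = 1 / real CARD('n) * (\<Sum>i\<in>UNIV. neg_part (y $ i * (\<beta> \<bullet> row i X) / N \<beta>) * N \<beta>)"
    by (simp add: sum_distrib_right)
  also have "\<dots> = 1 / real CARD('n) * (\<Sum>i\<in>UNIV. neg_part (y $ i * (\<beta> \<bullet> row i X)))"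
    by (simp only: scale[OF pos])
  also have "\<dots> \<le> logistic_loss X y \<beta>"
    unfolding logistic_loss_def by (intro mult_left_mono sum_mono neg_part_le_logistic) simp
  finally show ?thesis .
qed

section \<open>A scalar recursion and extended-real quotients\<close>

text \<open>While the terms are positive, their reciprocals grow by at least \<open>c\<close> per
  step. The bound is stated without reciprocals so that it also covers
  \<open>e 0 = 0\<close>.\<close>

lemma quadratic_decrease_rate:
  fixes e :: "nat \<Rightarrow> real"
  assumes nonneg: "\<And>k. 0 \<le> e k" and c: "0 \<le> c"
    and step: "\<And>k. e (Suc k) \<le> e k - c * (e k)\<^sup>2"
  shows "e k \<le> e 0 / (1 + e 0 * (real k * c))"
proof -
  have recip: "0 < e k \<Longrightarrow> 0 < e 0 \<and> 1 / e 0 + real k * c \<le> 1 / e k" for k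
  proof (induction k)
    case (Suc k)
    \<comment> \<open>Monotonicity carries positivity backwards, so every earlier reciprocal is
      meaningful.\<close>
    have "e (Suc k) \<le> e k"
      using step[of k] c by (smt (verit) mult_nonneg_nonneg zero_le_power2)
    then have pos: "0 < e k"
      using Suc.prems by linarith
    \<comment> \<open>The factor makes the right side a difference of squares, at most
      \<open>e k\<close>; dividing by \<open>e k * e (Suc k)\<close> then gives the reciprocal
      increment.\<close>
    have "e (Suc k) * (1 + c * e k) \<le> (e k - c * (e k)\<^sup>2) * (1 + c * e k)"
      using pos c by (intro mult_right_mono step) simp
    also have "\<dots> = e k - e k * (c * e k)\<^sup>2"
      by (simp add: power2_eq_square algebra_simps)
    also have "\<dots> \<le> e k"
      using pos by simp
    finally have "1 / e k + c \<le> 1 / e (Suc k)"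
      using pos Suc.prems by (simp add: field_simps)
    then show ?case
      using Suc.IH[OF pos] by (simp add: algebra_simps)
  qed simp
  have den: "0 < 1 + e 0 * (real k * c)"
    using nonneg[of 0] c by (simp add: add_pos_nonneg)
  show ?thesis
  proof (cases "e k = 0")
    case True
    then show ?thesis
      using nonneg[of 0] den by simp
  next
    case False
    then have pos: "0 < e k"
      using nonneg[of k] by linarith
    from recip[OF this] have "0 < e 0" "1 / e 0 + real k * c \<le> 1 / e k"
      by auto
    then show ?thesis
      using pos den by (simp add: field_simps)
  qed
qed

text \<open>For \<open>a = 0\<close> the inner quotient is infinite and the outer one 0, which
  agrees with the real formula. This occurs when the starting point is already optimal.\<close>

lemma ereal_one_divide_sum:
  fixes a b :: real
  assumes "0 \<le> a" "0 \<le> b"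
  shows "1 / (1 / ereal a + ereal b) = ereal (a / (1 + a * b))"
proof (cases "a = 0")
  case False
  then have "1 / a + b \<noteq> 0"
    using assms by (smt (verit) divide_pos_pos)
  then show ?thesis
    using False assms by (simp add: one_ereal_def field_simps)
qed (simp add: one_ereal_def zero_ereal_def[symmetric] divide_ereal_def)

text \<open>Makes the convention for a zero denominator explicit; it applies when
  \<open>k = 0\<close> or \<open>DegNSEP\<close> vanishes.\<close>

lemma ereal_divide_nonneg_cases:
  fixes p q :: real
  assumes "0 < p" "0 \<le> q"
  shows "ereal p / ereal q = (if q = 0 then \<infinity> else ereal (p / q))"
  using assms by (auto simp: divide_ereal_def zero_ereal_def[symmetric] divide_inverse)

section \<open>Analysis of an arbitrary run of steepest descent\<close>

locale logistic_steepest_descent =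
  fixes X :: "real^'p^'n" and y :: "real^'n"
    and N :: "real^'p \<Rightarrow> real"
    and \<alpha> :: "nat \<Rightarrow> real" and \<beta> :: "nat \<Rightarrow> real^'p"
  assumes norm_N: "is_norm N"
    and labels: "\<forall>i. y $ i \<in> {-1, 1}"
    and X_nonzero: "X \<noteq> 0"
    and descent: "steepest_descent N (logistic_loss X y) \<alpha> 0 \<beta>"
    and step_size: "\<forall>k. \<alpha> k =
          4 * real CARD('n) * dual_norm N (gradient (logistic_loss X y) (\<beta> k)) / (op_norm_2 N X)\<^sup>2"
begin

abbreviation "L \<equiv> logistic_loss X y"
abbreviation "Linf \<equiv> logistic_loss_inf X y"
abbreviation "G k \<equiv> dual_norm N (gradient L (\<beta> k))"
abbreviation "M \<equiv> op_norm_2 N X"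
abbreviation "D \<equiv> DegNSEP N X y"
abbreviation "e k \<equiv> L (\<beta> k) - Linf"

lemma card_pos: "0 < real CARD('n)"
  by simp

lemma M_pos: "0 < M"
  by (rule op_norm_2_pos[OF norm_N X_nonzero])

lemma beta_zero: "\<beta> 0 = 0"
  using descent by (simp add: steepest_descent_def)

lemma step_nonneg: "0 \<le> \<alpha> k"
  using descent by (simp add: steepest_descent_def)

lemma obtain_direction:
  obtains d where "N d \<le> 1" "gradient L (\<beta> k) \<bullet> d = G k" "\<beta> (Suc k) = \<beta> k - \<alpha> k *\<^sub>R d"
    "\<And>v. gradient L (\<beta> k) \<bullet> v \<le> G k * N v"
proof -
  obtain d where d: "is_arg_max (\<lambda>d. gradient L (\<beta> k) \<bullet> d) (\<lambda>d. N d \<le> 1) d"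
    "\<beta> (Suc k) = \<beta> k - \<alpha> k *\<^sub>R d"
    using descent unfolding steepest_descent_def by blast
  show thesis
    by (rule that[of d])
       (use d dual_norm_arg_max[OF d(1)] is_arg_max_inner_le[OF norm_N d(1)]
         in \<open>auto simp: is_arg_max_linorder\<close>)
qed

text \<open>The step size is a positive multiple of \<open>G k\<close> and is itself
  nonnegative.\<close>

lemma G_nonneg: "0 \<le> G k"
  using step_nonneg[of k] step_size[rule_format, of k] card_pos M_pos
  by (simp add: zero_le_divide_iff zero_le_mult_iff)

text \<open>Along the chosen direction the quadratic bound changes the loss by at most
  \<open>- \<alpha> * G + \<alpha>\<^sup>2 * M\<^sup>2 / (8 * n)\<close>. The prescribed step is the
  minimizer of this expression in \<open>\<alpha>\<close>, with value
  \<open>- 2 * n * G\<^sup>2 / M\<^sup>2\<close>.\<close>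

lemma sufficient_decrease: "L (\<beta> (Suc k)) \<le> L (\<beta> k) - 2 * real CARD('n) * (G k)\<^sup>2 / M\<^sup>2"
proof -
  obtain d where d: "N d \<le> 1" "gradient L (\<beta> k) \<bullet> d = G k" "\<beta> (Suc k) = \<beta> k - \<alpha> k *\<^sub>R d"
    by (rule obtain_direction)
  have diff: "\<beta> (Suc k) - \<beta> k = (- \<alpha> k) *\<^sub>R d"
    using d(3) by simp
  have "(norm (X *v (\<beta> (Suc k) - \<beta> k)))\<^sup>2 = (\<alpha> k)\<^sup>2 * (norm (X *v d))\<^sup>2"
    unfolding diff matrix_vector_mult_scaleR
    by (simp add: power_mult_distrib)
  also have "\<dots> \<le> (\<alpha> k)\<^sup>2 * M\<^sup>2"
    using norm_mult_le_op_norm_2[OF norm_N d(1)] by (intro mult_left_mono power_mono) auto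
  finally have "(norm (X *v (\<beta> (Suc k) - \<beta> k)))\<^sup>2 / (8 * real CARD('n)) \<le> (\<alpha> k)\<^sup>2 * M\<^sup>2 / (8 * real CARD('n))"
    by (rule divide_right_mono) simp
  moreover have "gradient L (\<beta> k) \<bullet> (\<beta> (Suc k) - \<beta> k) = - \<alpha> k * G k"
    unfolding diff using d(2) by simp
  ultimately have "L (\<beta> (Suc k)) \<le> L (\<beta> k) - \<alpha> k * G k + (\<alpha> k)\<^sup>2 * M\<^sup>2 / (8 * real CARD('n))"
    using logistic_loss_below_parabola[OF labels, of X "\<beta> (Suc k)" "\<beta> k"] by linarith
  also have "\<dots> = L (\<beta> k) - 2 * real CARD('n) * (G k)\<^sup>2 / M\<^sup>2"
    using M_pos card_pos unfolding step_size[rule_format, of k]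
    by (simp add: field_simps power2_eq_square)
  finally show ?thesis .
qed

lemma gap_nonneg: "0 \<le> e k"
  using logistic_loss_inf_le[of X y "\<beta> k"] by simp

lemma loss_le_ln_2: "L (\<beta> k) \<le> ln 2"
proof (induction k)
  case (Suc k)
  have "0 \<le> 2 * real CARD('n) * (G k)\<^sup>2 / M\<^sup>2"
    by simp
  then show ?case
    using sufficient_decrease[of k] Suc.IH by linarith
qed (simp add: beta_zero logistic_loss_zero)

text \<open>Comparing with an arbitrary \<open>\<gamma>\<close> and then taking the infimum avoids
  presupposing a minimizer. The factor 2 arises because \<open>D * N (\<beta> k)\<close> and
  \<open>D * N \<gamma>\<close> are each at most \<open>ln 2\<close>.\<close>

lemma gap_le_gradient: "D * e k \<le> 2 * ln 2 * G k"
proof -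
  have D: "0 \<le> D"
    by (rule DegNSEP_nonneg[OF norm_N])
  have main: "D * (L (\<beta> k) - L \<gamma>) \<le> 2 * ln 2 * G k" for \<gamma>
  proof (cases "L \<gamma> \<le> ln 2")
    case True
    have dual: "gradient L (\<beta> k) \<bullet> v \<le> G k * N v" for v
      by (rule obtain_direction[of k])
    have "L (\<beta> k) - L \<gamma> \<le> gradient L (\<beta> k) \<bullet> (\<beta> k - \<gamma>)"
      using logistic_loss_above_tangent[of X y "\<beta> k" \<gamma>] by (simp add: inner_diff_right)
    also have "\<dots> \<le> G k * (N (\<beta> k) + N \<gamma>)"
      using dual[of "\<beta> k - \<gamma>"] mult_left_mono[OF is_norm_diff_le[OF norm_N] G_nonneg]
      by (rule order_trans)
    finally have "D * (L (\<beta> k) - L \<gamma>) \<le> D * (G k * (N (\<beta> k) + N \<gamma>))"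
      using D by (rule mult_left_mono)
    also have "\<dots> = G k * (D * N (\<beta> k) + D * N \<gamma>)"
      by (simp add: algebra_simps)
    also have "\<dots> \<le> G k * (ln 2 + ln 2)"
      using DegNSEP_mult_le_logistic_loss[OF norm_N, of X y "\<beta> k"] loss_le_ln_2[of k]
        DegNSEP_mult_le_logistic_loss[OF norm_N, of X y \<gamma>] True
      by (intro mult_left_mono G_nonneg add_mono) linarith+
    finally show ?thesis
      by (simp add: mult.commute)
  next
    case False
    \<comment> \<open>Outside the sublevel set of the starting point, \<open>\<gamma>\<close> has
      larger loss than the iterate.\<close>
    then have "D * (L (\<beta> k) - L \<gamma>) \<le> 0"
      using D loss_le_ln_2[of k] by (intro mult_nonneg_nonpos) auto
    also have "0 \<le> 2 * ln 2 * G k"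
      using G_nonneg[of k] by simp
    finally show ?thesis .
  qed
  show ?thesis
  proof (cases "D = 0")
    case True
    then show ?thesis
      using G_nonneg[of k] by simp
  next
    case False
    then have "0 < D"
      using D by simp
    then have "L (\<beta> k) - 2 * ln 2 * G k / D \<le> L \<gamma>" for \<gamma>
      using main[of \<gamma>] by (simp add: field_simps)
    then have "L (\<beta> k) - 2 * ln 2 * G k / D \<le> Linf"
      unfolding logistic_loss_inf_def by (intro cINF_greatest) auto
    then show ?thesis
      using \<open>0 < D\<close> by (simp add: field_simps)
  qed
qed

text \<open>Squaring \<open>gap_le_gradient\<close> bounds \<open>(G k)\<^sup>2\<close> from below
  by a multiple of the squared gap, which turns the sufficient decrease into a recursion for the gap
  alone.\<close>

lemma gap_decrease: "e (Suc k) \<le> e k - real CARD('n) * D\<^sup>2 / (2 * M\<^sup>2 * (ln 2)\<^sup>2) * (e k)\<^sup>2"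
proof -
  have "(D * e k)\<^sup>2 \<le> (2 * ln 2 * G k)\<^sup>2"
    using gap_le_gradient[of k] gap_nonneg[of k] DegNSEP_nonneg[OF norm_N, of X y]
    by (intro power_mono) simp_all
  then have "D\<^sup>2 * (e k)\<^sup>2 / (4 * (ln 2)\<^sup>2) \<le> (G k)\<^sup>2"
    by (simp add: power_mult_distrib divide_le_eq mult_ac)
  then have "2 * real CARD('n) / M\<^sup>2 * (D\<^sup>2 * (e k)\<^sup>2 / (4 * (ln 2)\<^sup>2)) \<le> 2 * real CARD('n) / M\<^sup>2 * (G k)\<^sup>2"
    by (intro mult_left_mono) simp_all
  then show ?thesis
    using sufficient_decrease[of k] by (simp add: field_simps)
qed

lemma gap_rate:
  "e k \<le> (ln 2 - Linf) / (1 + (ln 2 - Linf) * (real k * real CARD('n) * D\<^sup>2 / (2 * M\<^sup>2 * (ln 2)\<^sup>2)))"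
  using quadratic_decrease_rate[of e, OF gap_nonneg _ gap_decrease, of k]
  by (simp add: beta_zero logistic_loss_zero algebra_simps)

text \<open>Uses \<open>a / (1 + a * b) \<le> 1 / b\<close>; this form of the rate feeds the
  gradient bound.\<close>

lemma gap_rate_simple:
  assumes "0 < real k * real CARD('n) * D\<^sup>2"
  shows "e k \<le> 2 * M\<^sup>2 * (ln 2)\<^sup>2 / (real k * real CARD('n) * D\<^sup>2)"
proof -
  define b where "b = real k * real CARD('n) * D\<^sup>2 / (2 * M\<^sup>2 * (ln 2)\<^sup>2)"
  have b: "0 < b"
    unfolding b_def using assms M_pos by (intro divide_pos_pos) simp_all
  have a: "0 \<le> ln 2 - Linf"
    using gap_nonneg[of 0] by (simp add: beta_zero logistic_loss_zero)
  have "e k \<le> (ln 2 - Linf) / (1 + (ln 2 - Linf) * b)"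
    using gap_rate unfolding b_def .
  also have "\<dots> \<le> 1 / b"
  proof -
    have "0 < 1 + (ln 2 - Linf) * b"
      using a b by (simp add: add_pos_nonneg)
    then show ?thesis
      using b by (simp add: frac_le_eq divide_le_0_iff)
  qed
  finally show ?thesis
    by (simp add: b_def)
qed

text \<open>Telescoping of \<open>sufficient_decrease\<close>, starting from the loss
  \<open>ln 2\<close> at the origin.\<close>

lemma sum_gradient_sq: "2 * real CARD('n) / M\<^sup>2 * (\<Sum>j<k. (G j)\<^sup>2) \<le> ln 2 - L (\<beta> k)"
proof (induction k)
  case (Suc k)
  then show ?case
    using sufficient_decrease[of k] by (simp add: algebra_simps)
qed (simp add: beta_zero logistic_loss_zero)

lemma norm_iterate_le_sum: "N (\<beta> k) \<le> (\<Sum>j<k. \<alpha> j)"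
proof (induction k)
  case 0
  then show ?case
    using is_normD(2)[OF norm_N, of 0] by (simp add: beta_zero)
next
  case (Suc k)
  obtain d where d: "N d \<le> 1" "\<beta> (Suc k) = \<beta> k - \<alpha> k *\<^sub>R d"
    by (rule obtain_direction)
  have "N (\<beta> (Suc k)) \<le> N (\<beta> k) + \<alpha> k * N d"
    unfolding d(2) using is_norm_diff_le[OF norm_N, of "\<beta> k" "\<alpha> k *\<^sub>R d"] step_nonneg[of k]
    by (simp add: is_normD(3)[OF norm_N])
  also have "\<dots> \<le> N (\<beta> k) + \<alpha> k"
    using mult_left_mono[OF d(1) step_nonneg[of k]] by simp
  finally show ?case
    using Suc.IH by simp
qed

lemma norm_iterate_le: "N (\<beta> k) \<le> sqrt (real k) * (1 / M) * sqrt (8 * real CARD('n) * (ln 2 - Linf))"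
proof -
  have "(\<Sum>j<k. \<alpha> j)\<^sup>2 \<le> real k * (\<Sum>j<k. (\<alpha> j)\<^sup>2)"
    using Cauchy_Schwarz_ineq_sum[of "\<lambda>_. 1" \<alpha> "{..<k}"] by simp
  \<comment> \<open>Splitting the constant \<open>16 * n\<^sup>2 / M ^ 4\<close> in this way
    isolates the telescoped decrease.\<close>
  also have "(\<Sum>j<k. (\<alpha> j)\<^sup>2) = 8 * real CARD('n) / M\<^sup>2 * (2 * real CARD('n) / M\<^sup>2 * (\<Sum>j<k. (G j)\<^sup>2))"
    unfolding step_size[rule_format]
    by (simp add: sum_distrib_left power_mult_distrib power_divide) (simp add: power2_eq_square mult.assoc)
  also have "\<dots> \<le> 8 * real CARD('n) / M\<^sup>2 * (ln 2 - Linf)"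
    using sum_gradient_sq[of k] gap_nonneg[of k] by (intro mult_left_mono) auto
  finally have "(\<Sum>j<k. \<alpha> j)\<^sup>2 \<le> real k * (8 * real CARD('n) / M\<^sup>2 * (ln 2 - Linf))"
    by (simp add: mult_left_mono)
  then have "(\<Sum>j<k. \<alpha> j) \<le> sqrt (real k * (8 * real CARD('n) / M\<^sup>2 * (ln 2 - Linf)))"
    by (rule real_le_rsqrt)
  also have "\<dots> = sqrt (real k) * (1 / M) * sqrt (8 * real CARD('n) * (ln 2 - Linf))"
    using M_pos by (simp add: real_sqrt_mult real_sqrt_divide)
  finally show ?thesis
    using norm_iterate_le_sum[of k] by linarith
qed

text \<open>The next gap is still nonnegative, so the guaranteed decrease cannot exceed the current
  gap.\<close>

lemma gradient_le: "G k \<le> M * sqrt (e k / (2 * real CARD('n)))"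
proof -
  have "2 * real CARD('n) * (G k)\<^sup>2 / M\<^sup>2 \<le> e k"
    using sufficient_decrease[of k] gap_nonneg[of "Suc k"] by linarith
  then have "(G k)\<^sup>2 \<le> M\<^sup>2 * (e k / (2 * real CARD('n)))"
    using M_pos card_pos by (simp add: field_simps)
  then have "G k \<le> sqrt (M\<^sup>2 * (e k / (2 * real CARD('n))))"
    by (rule real_le_rsqrt)
  also have "\<dots> = M * sqrt (e k / (2 * real CARD('n)))"
    using M_pos by (simp only: real_sqrt_mult real_sqrt_abs abs_of_pos)
  finally show ?thesis .
qed

text \<open>Inserting the simple rate under the root produces a perfect square.\<close>

lemma gradient_bound_rate:
  assumes "0 < k" "0 < D"
  shows "M * sqrt (e k / (2 * real CARD('n))) \<le> M\<^sup>2 * ln 2 / (sqrt (real k) * real CARD('n) * D)"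
proof -
  have "e k / (2 * real CARD('n)) \<le> 2 * M\<^sup>2 * (ln 2)\<^sup>2 / (real k * real CARD('n) * D\<^sup>2) / (2 * real CARD('n))"
    using assms by (intro divide_right_mono gap_rate_simple) simp_all
  also have "\<dots> = (M * ln 2 / (sqrt (real k) * real CARD('n) * D))\<^sup>2"
    using assms by (simp add: power_divide power_mult_distrib) (simp add: field_simps power2_eq_square)
  finally have "sqrt (e k / (2 * real CARD('n))) \<le> M * ln 2 / (sqrt (real k) * real CARD('n) * D)"
    using assms M_pos by (intro real_le_lsqrt) simp_all
  then have "M * sqrt (e k / (2 * real CARD('n))) \<le> M * (M * ln 2 / (sqrt (real k) * real CARD('n) * D))"
    using M_pos by (intro mult_left_mono) simp_all
  then show ?thesis
    by (simp add: power2_eq_square mult.assoc)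
qed

end

section \<open>The three bounds with extended-real right-hand sides\<close>

theorem theorem3p2:
  fixes X :: "real^'p^'n" and y :: "real^'n"
    and N :: "real^'p \<Rightarrow> real"
    and \<alpha> :: "nat \<Rightarrow> real" and \<beta> :: "nat \<Rightarrow> real^'p"
  assumes norm_N: "is_norm N"
    and labels: "\<forall>i. y $ i \<in> {-1, 1}"
    and X_nonzero: "X \<noteq> 0"
    and descent: "steepest_descent N (logistic_loss X y) \<alpha> 0 \<beta>"
    and step_size: "\<forall>k. \<alpha> k =
          4 * real CARD('n) * dual_norm N (gradient (logistic_loss X y) (\<beta> k)) / (op_norm_2 N X)\<^sup>2"
    and nonseparable: "\<not> separable X y"
  shows "\<forall>k.
    (ereal (logistic_loss X y (\<beta> k) - logistic_loss_inf X y)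
       \<le> 1 / (1 / ereal (ln 2 - logistic_loss_inf X y)
              + ereal (real k * real CARD('n) * (DegNSEP N X y)\<^sup>2
                       / (2 * (op_norm_2 N X)\<^sup>2 * (ln 2)\<^sup>2)))
     \<and> 1 / (1 / ereal (ln 2 - logistic_loss_inf X y)
              + ereal (real k * real CARD('n) * (DegNSEP N X y)\<^sup>2
                       / (2 * (op_norm_2 N X)\<^sup>2 * (ln 2)\<^sup>2)))
       < ereal (2 * (op_norm_2 N X)\<^sup>2 * (ln 2)\<^sup>2)
         / ereal (real k * real CARD('n) * (DegNSEP N X y)\<^sup>2))
    \<and>
    (N (\<beta> k) \<le> sqrt (real k) * (1 / op_norm_2 N X)
                * sqrt (8 * real CARD('n) * (ln 2 - logistic_loss_inf X y))
     \<and> sqrt (real k) * (1 / op_norm_2 N X)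
                * sqrt (8 * real CARD('n) * (ln 2 - logistic_loss_inf X y))
       \<le> sqrt (real k) * (1 / op_norm_2 N X) * sqrt (8 * real CARD('n) * ln 2))
    \<and>
    (dual_norm N (gradient (logistic_loss X y) (\<beta> k))
       \<le> op_norm_2 N X
         * sqrt ((logistic_loss X y (\<beta> k) - logistic_loss_inf X y) / (2 * real CARD('n)))
     \<and> ereal (op_norm_2 N X
         * sqrt ((logistic_loss X y (\<beta> k) - logistic_loss_inf X y) / (2 * real CARD('n))))
       \<le> ereal ((op_norm_2 N X)\<^sup>2 * ln 2)
         / ereal (sqrt (real k) * real CARD('n) * DegNSEP N X y))"
proof (intro allI conjI)
  interpret logistic_steepest_descent X y N \<alpha> \<beta>
    by unfold_locales (fact norm_N labels X_nonzero descent step_size)+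
  fix k
  define a where "a = ln 2 - Linf"
  define q where "q = real k * real CARD('n) * D\<^sup>2"
  define p where "p = 2 * M\<^sup>2 * (ln 2)\<^sup>2"
  have a: "0 \<le> a"
    using gap_nonneg[of 0] by (simp add: a_def beta_zero logistic_loss_zero)
  have q: "0 \<le> q"
    by (simp add: q_def)
  have p: "0 < p"
    using M_pos by (simp add: p_def)
  have D: "0 \<le> D"
    by (rule DegNSEP_nonneg[OF norm_N])
  have mid: "1 / (1 / ereal a + ereal (q / p)) = ereal (a / (1 + a * (q / p)))"
    using a q p by (intro ereal_one_divide_sum) simp_all
  show "ereal (e k) \<le> 1 / (1 / ereal (ln 2 - Linf)
      + ereal (real k * real CARD('n) * D\<^sup>2 / (2 * M\<^sup>2 * (ln 2)\<^sup>2)))"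
    using gap_rate[of k] unfolding a_def[symmetric] q_def[symmetric] p_def[symmetric] mid by simp
  \<comment> \<open>Clearing denominators reduces this to \<open>a * q < p + a * q\<close>, so
    strictness comes from \<open>0 < p\<close>. For \<open>q = 0\<close> the right-hand side of the
    goal is infinite.\<close>
  have "a / (1 + a * (q / p)) < p / q" if "q \<noteq> 0"
  proof -
    have "0 < q"
      using q that by simp
    moreover have "0 < p + a * q"
      using a p q by (simp add: add_pos_nonneg)
    ultimately show ?thesis
      using a p by (simp add: field_simps)
  qed
  then show "1 / (1 / ereal (ln 2 - Linf) + ereal (real k * real CARD('n) * D\<^sup>2 / (2 * M\<^sup>2 * (ln 2)\<^sup>2)))
      < ereal (2 * M\<^sup>2 * (ln 2)\<^sup>2) / ereal (real k * real CARD('n) * D\<^sup>2)"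
    unfolding a_def[symmetric] q_def[symmetric] p_def[symmetric] mid
      ereal_divide_nonneg_cases[OF p q] by simp
  show "N (\<beta> k) \<le> sqrt (real k) * (1 / M) * sqrt (8 * real CARD('n) * (ln 2 - Linf))"
    by (rule norm_iterate_le)
  show "sqrt (real k) * (1 / M) * sqrt (8 * real CARD('n) * (ln 2 - Linf))
      \<le> sqrt (real k) * (1 / M) * sqrt (8 * real CARD('n) * ln 2)"
    using M_pos logistic_loss_inf_nonneg[of X y]
    by (intro mult_left_mono real_sqrt_le_mono) simp_all
  show "G k \<le> M * sqrt (e k / (2 * real CARD('n)))"
    by (rule gradient_le)
  have "0 < M\<^sup>2 * ln 2" "0 \<le> sqrt (real k) * real CARD('n) * D"
    using M_pos D by simp_all
  \<comment> \<open>Only a nonzero denominator, that is \<open>k > 0\<close> and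
    \<open>D > 0\<close>, calls for \<open>gradient_bound_rate\<close>; otherwise the bound is
    infinite.\<close>
  then show "ereal (M * sqrt (e k / (2 * real CARD('n)))) \<le> ereal (M\<^sup>2 * ln 2) / ereal (sqrt (real k) * real CARD('n) * D)"
    using gradient_bound_rate[of k] D by (simp add: ereal_divide_nonneg_cases)
qed

end
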